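(* Let $s\in(0,1)$, $1<p<+\infty$, and let $\Omega$ be an open bounded set in $\mathbb{R}^N$. For every sequence $\{s_j\}_j\subset(0,1)$ strictly increasing to $s$, it holds, with respect to $\Gamma$-convergence in $L^p(\Omega)$, $$\Gamma\text{-}\lim_{j\to+\infty}\underline{\mathcal{E}}^{s_j}=\Gamma\text{-}\lim_{j\to+\infty}\mathcal{E}^{s_j}=\underline{\mathcal{E}}^{s}.$$
   Context: For $0<\sigma<1$, $W^{\sigma,p}(\Omega)$ is the space of $u\in L^p(\Omega)$ with $\int_{\Omega\times\Omega}\frac{|u(x)-u(y)|^p}{|x-y|^{N+\sigma p}}\,dx\,dy<\infty$, with its usual norm. $W^{\sigma,p}_0(\Omega)$ is the closure of $C_0^\infty(\Omega)$ (smooth functions compactly supported in $\Omega$) in $W^{\sigma,p}(\Omega)$. No regularity of $\partial\Omega$ is assumed. Set $$W^{\sigma^-,p}_0(\Omega)=W^{\sigma,p}(\Omega)\cap\Big(\bigcap_{0<k<\sigma}W^{k,p}_0(\Omega)\Big).$$ Define $\mathcal{E}^\sigma,\underline{\mathcal{E}}^\sigma:L^p(\Omega)\to[0,+\infty]$ by $$\mathcal{E}^\sigma(u)=\int_{\Omega\times\Omega}\frac{|u(x)-u(y)|^p}{|x-y|^{N+\sigma p}}\,dx\,dy\ \text{ if }u\in W^{\sigma,p}_0(\Omega),\quad+\infty\text{ otherwise},$$ $$\underline{\mathcal{E}}^\sigma(u)=\int_{\Omega\times\Omega}\frac{|u(x)-u(y)|^p}{|x-y|^{N+\sigma p}}\,dx\,dy\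 \text{ if }u\in W^{\sigma^-,p}_0(\Omega),\quad+\infty\text{ otherwise}.$$ $\Gamma$-convergence: for a metric space $X$, functionals $E_n:X\to\mathbb{R}\cup\{\infty\}$ $\Gamma$-converge to $E$ if (a) for every $u\in X$ and every $u_n\to u$ in $X$, $E(u)\le\liminf_n E_n(u_n)$; and (b) for every $u\in X$ there is a sequence $u_n\to u$ in $X$ with $E(u)\ge\limsup_n E_n(u_n)$. Here $X=L^p(\Omega)$ with its norm metric. *)

theory Defs
  imports "HOL-Analysis.Analysis"
begin

text \<open>
  Functions on an open set \<open>\<Omega>\<close> of a Euclidean space (of dimension \<open>N = DIM('a)\<close>) are total
  functions whose values outside \<open>\<Omega>\<close> are irrelevant. Elements of \<open>L\<^sup>p(\<Omega>)\<close> and of the Sobolev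
  spaces are given by representatives: all norms, spaces and functionals below are invariant
  under changes on null sets, and \<open>Lp_dist\<close> is the norm metric read on representatives.
\<close>

definition Lp :: "real \<Rightarrow> 'a::euclidean_space set \<Rightarrow> ('a \<Rightarrow> real) set" where
  "Lp p \<Omega> = {u. u \<in> borel_measurable (lebesgue_on \<Omega>) \<and>
                 integrable (lebesgue_on \<Omega>) (\<lambda>x. \<bar>u x\<bar> powr p)}"

definition Lp_norm :: "real \<Rightarrow> 'a::euclidean_space set \<Rightarrow> ('a \<Rightarrow> real) \<Rightarrow> real" where
  "Lp_norm p \<Omega> u = (LINT x|lebesgue_on \<Omega>. \<bar>u x\<bar> powr p) powr (1 / p)"

definition Lp_dist ::
    "real \<Rightarrow> 'a::euclidean_space set \<Rightarrow> ('a \<Rightarrow> real) \<Rightarrow> ('a \<Rightarrow> real) \<Rightarrow> real" where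
  "Lp_dist p \<Omega> u v = Lp_norm p \<Omega> (\<lambda>x. u x - v x)"

text \<open>On the (null) diagonal the integrand is \<open>0 / 0 = 0\<close>.\<close>

definition gagliardo ::
    "real \<Rightarrow> real \<Rightarrow> 'a::euclidean_space set \<Rightarrow> ('a \<Rightarrow> real) \<Rightarrow> ennreal" where
  "gagliardo \<sigma> p \<Omega> u =
     (\<integral>\<^sup>+ (x, y). ennreal (\<bar>u x - u y\<bar> powr p / norm (x - y) powr (real DIM('a) + \<sigma> * p))
        \<partial>(lebesgue_on \<Omega> \<Otimes>\<^sub>M lebesgue_on \<Omega>))"

definition sobolev ::
    "real \<Rightarrow> real \<Rightarrow> 'a::euclidean_space set \<Rightarrow> ('a \<Rightarrow> real) set" where
  "sobolev \<sigma> p \<Omega> = {u \<in> Lp p \<Omega>. gagliardo \<sigma> p \<Omega> u < \<infinity>}"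

text \<open>Meaningful for \<open>u \<in> sobolev \<sigma> p \<Omega>\<close> only, since \<open>enn2real \<infinity> = 0\<close>.\<close>

definition sobolev_norm ::
    "real \<Rightarrow> real \<Rightarrow> 'a::euclidean_space set \<Rightarrow> ('a \<Rightarrow> real) \<Rightarrow> real" where
  "sobolev_norm \<sigma> p \<Omega> u =
     ((LINT x|lebesgue_on \<Omega>. \<bar>u x\<bar> powr p) + enn2real (gagliardo \<sigma> p \<Omega> u)) powr (1 / p)"

fun C_k :: "nat \<Rightarrow> ('a::euclidean_space \<Rightarrow> real) \<Rightarrow> bool" where
  "C_k 0 f \<longleftrightarrow> continuous_on UNIV f"
| "C_k (Suc k) f \<longleftrightarrow> (\<forall>x. f differentiable (at x)) \<and>
                      (\<forall>v. C_k k (\<lambda>x. frechet_derivative f (at x) v))"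

definition test_functions :: "'a::euclidean_space set \<Rightarrow> ('a \<Rightarrow> real) set" where
  "test_functions \<Omega> = {\<phi>. (\<forall>k. C_k k \<phi>) \<and> compact (closure {x. \<phi> x \<noteq> 0}) \<and>
                           closure {x. \<phi> x \<noteq> 0} \<subseteq> \<Omega>}"

text \<open>
  The closure is taken inside \<open>sobolev \<sigma> p \<Omega>\<close>. For \<open>0 < \<sigma> < 1\<close> test functions belong to that
  space; the intersection makes explicit that the norm is evaluated inside it.
\<close>

definition sobolev_0 ::
    "real \<Rightarrow> real \<Rightarrow> 'a::euclidean_space set \<Rightarrow> ('a \<Rightarrow> real) set" where
  "sobolev_0 \<sigma> p \<Omega> =
     {u \<in> sobolev \<sigma> p \<Omega>. \<forall>\<epsilon>>0. \<exists>\<phi> \<in> test_functions \<Omega> \<inter> sobolev \<sigma> p \<Omega>.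
        sobolev_norm \<sigma> p \<Omega> (\<lambda>x. u x - \<phi> x) < \<epsilon>}"

definition sobolev_0_minus ::
    "real \<Rightarrow> real \<Rightarrow> 'a::euclidean_space set \<Rightarrow> ('a \<Rightarrow> real) set" where
  "sobolev_0_minus \<sigma> p \<Omega> = sobolev \<sigma> p \<Omega> \<inter> (\<Inter>k\<in>{0<..<\<sigma>}. sobolev_0 k p \<Omega>)"

definition energy ::
    "real \<Rightarrow> real \<Rightarrow> 'a::euclidean_space set \<Rightarrow> ('a \<Rightarrow> real) \<Rightarrow> ereal" where
  "energy \<sigma> p \<Omega> u =
     (if u \<in> sobolev_0 \<sigma> p \<Omega> then enn2ereal (gagliardo \<sigma> p \<Omega> u) else \<infinity>)"

definition energy_minus ::
    "real \<Rightarrow> real \<Rightarrow> 'a::euclidean_space set \<Rightarrow> ('a \<Rightarrow> real) \<Rightarrow> ereal" where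
  "energy_minus \<sigma> p \<Omega> u =
     (if u \<in> sobolev_0_minus \<sigma> p \<Omega> then enn2ereal (gagliardo \<sigma> p \<Omega> u) else \<infinity>)"

definition Gamma_converges ::
    "'x set \<Rightarrow> ('x \<Rightarrow> 'x \<Rightarrow> real) \<Rightarrow> (nat \<Rightarrow> 'x \<Rightarrow> ereal) \<Rightarrow> ('x \<Rightarrow> ereal) \<Rightarrow> bool" where
  "Gamma_converges X d F E \<longleftrightarrow>
     (\<forall>u\<in>X. \<forall>v. (\<forall>n. v n \<in> X) \<and> (\<lambda>n. d (v n) u) \<longlonglongrightarrow> 0 \<longrightarrow>
        E u \<le> liminf (\<lambda>n. F n (v n))) \<and>
     (\<forall>u\<in>X. \<exists>v. (\<forall>n. v n \<in> X) \<and> (\<lambda>n. d (v n) u) \<longlonglongrightarrow> 0 \<and>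
        limsup (\<lambda>n. F n (v n)) \<le> E u)"

end

theory Submission
  imports Defs
begin

text \<open>
  On a bounded set the kernels for exponents \<open>k \<le> \<sigma>\<close> compare up to the factor \<open>R powr ((\<sigma> - k) * p)\<close>,
  which tends to \<open>1\<close> as \<open>k \<rightarrow> \<sigma>\<close>; hence constant sequences are recovery sequences. For the lower bound,
  pass to a subsequence converging almost everywhere and apply Fatou's lemma to the seminorms with
  varying exponent. That the limit lies in \<open>sobolev_0 k p \<Omega>\<close> for \<open>k < s\<close> needs no weak compactness:
  splitting the seminorm at distance \<open>\<delta>\<close>, the short-range part is at most \<open>\<delta> powr ((k' - k) * p)\<close> times
  a bounded seminorm of order \<open>k' \<in> (k, s)\<close> and the long-range part is controlled by the \<open>L\<^sup>p\<close> norm, so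
  convergence is strong for the exponent \<open>k\<close>, and \<open>sobolev_0 k p \<Omega>\<close> is closed.
\<close>

section \<open>Powers, seminorms and their quasi-triangle inequality\<close>

text \<open>The constant comes from |a + b| \<le> 2 max(|a|, |b|). Working with p-th powers and the
  factor \<open>2 powr p\<close> replaces Minkowski's inequality: all later estimates compare
  integrands pointwise and integrate in \<open>ennreal\<close>.\<close>

lemma abs_add_powr_le:
  fixes a b p :: real
  assumes "0 \<le> p"
  shows "\<bar>a + b\<bar> powr p \<le> 2 powr p * (\<bar>a\<bar> powr p + \<bar>b\<bar> powr p)"
proof -
  define m where "m = max \<bar>a\<bar> \<bar>b\<bar>"
  have "\<bar>a + b\<bar> powr p \<le> (2 * m) powr p"
    using assms by (intro powr_mono2) (auto simp: m_def)
  also have "\<dots> = 2 powr p * m powr p"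
    by (simp add: powr_mult m_def)
  also have "m powr p \<le> \<bar>a\<bar> powr p + \<bar>b\<bar> powr p"
    by (auto simp: m_def max_def)
  finally show ?thesis by simp
qed

text \<open>Lets the \<open>measurable\<close> method treat the kernel \<open>norm (x - y)\<close>,
  whose variables range over Lebesgue rather than Borel spaces.\<close>

lemma id_borel_measurable_lebesgue_on [measurable]:
  "(\<lambda>x. x) \<in> borel_measurable (lebesgue_on \<Omega>)"
  by (intro measurable_restrict_space1 measurable_completion) simp

lemma Lp_iff:
  "u \<in> Lp p \<Omega> \<longleftrightarrow> u \<in> borel_measurable (lebesgue_on \<Omega>) \<and>
     (\<integral>\<^sup>+ x. ennreal (\<bar>u x\<bar> powr p) \<partial>lebesgue_on \<Omega>) < \<infinity>"
  by (auto simp: Lp_def integrable_iff_bounded)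

lemma gagliardo_integrand_measurable [measurable]:
  fixes \<Omega> :: "'a::euclidean_space set"
  assumes [measurable]: "u \<in> borel_measurable (lebesgue_on \<Omega>)"
  shows "(\<lambda>(x, y). ennreal (\<bar>u x - u y\<bar> powr p / norm (x - y) powr q))
           \<in> borel_measurable (lebesgue_on \<Omega> \<Otimes>\<^sub>M lebesgue_on \<Omega>)"
  by measurable

text \<open>The p-th power of the Sobolev norm, kept in \<open>ennreal\<close>: finiteness then
  expresses membership, and an infinite value is not collapsed to 0 as it is by
  \<open>enn2real\<close>.\<close>

definition sobolev_mass ::
    "real \<Rightarrow> real \<Rightarrow> 'a::euclidean_space set \<Rightarrow> ('a \<Rightarrow> real) \<Rightarrow> ennreal" where
  "sobolev_mass \<sigma> p \<Omega> u =
     (\<integral>\<^sup>+ x. ennreal (\<bar>u x\<bar> powr p) \<partial>lebesgue_on \<Omega>) + gagliardo \<sigma> p \<Omega> u"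

lemma sobolev_iff:
  "u \<in> sobolev \<sigma> p \<Omega> \<longleftrightarrow>
     u \<in> borel_measurable (lebesgue_on \<Omega>) \<and> sobolev_mass \<sigma> p \<Omega> u < \<infinity>"
  by (auto simp: sobolev_def Lp_iff sobolev_mass_def)

lemma nn_integral_abs_add_powr_le:
  assumes [measurable]: "u \<in> borel_measurable M" "v \<in> borel_measurable M" and "0 \<le> p"
  shows "(\<integral>\<^sup>+ x. ennreal (\<bar>u x + v x\<bar> powr p) \<partial>M) \<le>
     ennreal (2 powr p) * ((\<integral>\<^sup>+ x. ennreal (\<bar>u x\<bar> powr p) \<partial>M) + (\<integral>\<^sup>+ x. ennreal (\<bar>v x\<bar> powr p) \<partial>M))"
proof -
  have "(\<integral>\<^sup>+ x. ennreal (\<bar>u x + v x\<bar> powr p) \<partial>M) \<le>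
    (\<integral>\<^sup>+ x. ennreal (2 powr p) * (ennreal (\<bar>u x\<bar> powr p) + ennreal (\<bar>v x\<bar> powr p)) \<partial>M)"
    using abs_add_powr_le[OF \<open>0 \<le> p\<close>]
    by (intro nn_integral_mono) (simp flip: ennreal_plus ennreal_mult)
  then show ?thesis
    by (simp add: nn_integral_cmult nn_integral_add)
qed

lemma gagliardo_add_le:
  fixes \<Omega> :: "'a::euclidean_space set"
  assumes [measurable]: "u \<in> borel_measurable (lebesgue_on \<Omega>)" "v \<in> borel_measurable (lebesgue_on \<Omega>)"
    and "0 \<le> p"
  shows "gagliardo \<sigma> p \<Omega> (\<lambda>x. u x + v x) \<le>
           ennreal (2 powr p) * (gagliardo \<sigma> p \<Omega> u + gagliardo \<sigma> p \<Omega> v)"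
proof -
  let ?P = "lebesgue_on \<Omega> \<Otimes>\<^sub>M lebesgue_on \<Omega>" and ?q = "real DIM('a) + \<sigma> * p"
  let ?g = "\<lambda>u (x, y). ennreal (\<bar>u x - u y\<bar> powr p / norm (x - y) powr ?q)"
  have "gagliardo \<sigma> p \<Omega> (\<lambda>x. u x + v x) \<le> (\<integral>\<^sup>+ z. ennreal (2 powr p) * (?g u z + ?g v z) \<partial>?P)"
    unfolding gagliardo_def
  proof (intro nn_integral_mono, clarify)
    fix x y
    have "\<bar>u x + v x - (u y + v y)\<bar> powr p / norm (x - y) powr ?q \<le>
        2 powr p * (\<bar>u x - u y\<bar> powr p + \<bar>v x - v y\<bar> powr p) / norm (x - y) powr ?q"
      using abs_add_powr_le[OF \<open>0 \<le> p\<close>, of "u x - u y" "v x - v y"]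
      by (intro divide_right_mono) (simp_all add: algebra_simps)
    also have "\<dots> = 2 powr p * (\<bar>u x - u y\<bar> powr p / norm (x - y) powr ?q
        + \<bar>v x - v y\<bar> powr p / norm (x - y) powr ?q)"
      by (simp add: add_divide_distrib distrib_left)
    finally show "ennreal (\<bar>u x + v x - (u y + v y)\<bar> powr p / norm (x - y) powr ?q)
        \<le> ennreal (2 powr p) * (ennreal (\<bar>u x - u y\<bar> powr p / norm (x - y) powr ?q)
        + ennreal (\<bar>v x - v y\<bar> powr p / norm (x - y) powr ?q))"
      by (simp flip: ennreal_plus ennreal_mult)
  qed
  also have "\<dots> = ennreal (2 powr p) * (gagliardo \<sigma> p \<Omega> u + gagliardo \<sigma> p \<Omega> v)"
    unfolding gagliardo_def by (simp add: nn_integral_cmult nn_integral_add)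
  finally show ?thesis .
qed

lemma sobolev_mass_add_le:
  assumes "u \<in> borel_measurable (lebesgue_on \<Omega>)" "v \<in> borel_measurable (lebesgue_on \<Omega>)" "0 \<le> p"
  shows "sobolev_mass \<sigma> p \<Omega> (\<lambda>x. u x + v x) \<le>
           ennreal (2 powr p) * (sobolev_mass \<sigma> p \<Omega> u + sobolev_mass \<sigma> p \<Omega> v)"
  unfolding sobolev_mass_def
  using add_mono[OF nn_integral_abs_add_powr_le[OF assms] gagliardo_add_le[OF assms]]
  by (simp add: algebra_simps)

lemma gagliardo_uminus: "gagliardo \<sigma> p \<Omega> (\<lambda>x. - u x) = gagliardo \<sigma> p \<Omega> u"
  unfolding gagliardo_def by (simp add: abs_minus_commute)

lemma sobolev_mass_uminus: "sobolev_mass \<sigma> p \<Omega> (\<lambda>x. - u x) = sobolev_mass \<sigma> p \<Omega> u"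
  unfolding sobolev_mass_def by (simp add: gagliardo_uminus)

text \<open>Guarantees that the norm in the definition of \<open>sobolev_0\<close> is only evaluated
  inside the space, where the default \<open>enn2real \<infinity> = 0\<close> does not
  interfere.\<close>

lemma sobolev_diff:
  assumes "u \<in> sobolev \<sigma> p \<Omega>" "v \<in> sobolev \<sigma> p \<Omega>" "0 \<le> p"
  shows "(\<lambda>x. u x - v x) \<in> sobolev \<sigma> p \<Omega>"
proof -
  have [measurable]: "u \<in> borel_measurable (lebesgue_on \<Omega>)" "v \<in> borel_measurable (lebesgue_on \<Omega>)"
    and fin: "sobolev_mass \<sigma> p \<Omega> u < \<infinity>" "sobolev_mass \<sigma> p \<Omega> v < \<infinity>"
    using assms by (auto simp: sobolev_iff)
  have "sobolev_mass \<sigma> p \<Omega> (\<lambda>x. u x + - v x) \<le>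
           ennreal (2 powr p) * (sobolev_mass \<sigma> p \<Omega> u + sobolev_mass \<sigma> p \<Omega> (\<lambda>x. - v x))"
    by (rule sobolev_mass_add_le) (use assms in measurable)
  also have "\<dots> < \<infinity>"
    using fin by (simp add: sobolev_mass_uminus ennreal_mult_less_top)
  finally show ?thesis by (simp add: sobolev_iff)
qed

lemma sobolev_norm_eq:
  assumes "u \<in> sobolev \<sigma> p \<Omega>"
  shows "sobolev_norm \<sigma> p \<Omega> u = enn2real (sobolev_mass \<sigma> p \<Omega> u) powr (1 / p)"
proof -
  have "u \<in> borel_measurable (lebesgue_on \<Omega>)" and
    fin: "(\<integral>\<^sup>+ x. ennreal (\<bar>u x\<bar> powr p) \<partial>lebesgue_on \<Omega>) < \<infinity>" "gagliardo \<sigma> p \<Omega> u < \<infinity>"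
    using assms by (auto simp: sobolev_def Lp_iff)
  then have "(LINT x|lebesgue_on \<Omega>. \<bar>u x\<bar> powr p) =
      enn2real (\<integral>\<^sup>+ x. ennreal (\<bar>u x\<bar> powr p) \<partial>lebesgue_on \<Omega>)"
    by (intro integral_eq_nn_integral) auto
  then show ?thesis
    using fin by (simp add: sobolev_norm_def sobolev_mass_def enn2real_plus)
qed

lemma sobolev_norm_less_iff:
  assumes "u \<in> sobolev \<sigma> p \<Omega>" "0 < p" "0 < \<epsilon>"
  shows "sobolev_norm \<sigma> p \<Omega> u < \<epsilon> \<longleftrightarrow> sobolev_mass \<sigma> p \<Omega> u < ennreal (\<epsilon> powr p)"
proof -
  obtain m where m: "0 \<le> m" "sobolev_mass \<sigma> p \<Omega> u = ennreal m"
    using assms(1) by (cases "sobolev_mass \<sigma> p \<Omega> u") (auto simp: sobolev_iff)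
  have "m powr (1 / p) < \<epsilon> \<longleftrightarrow> (m powr (1 / p)) powr p < \<epsilon> powr p"
    using assms by (smt (verit) powr_ge_zero powr_less_mono2 powr_mono2)
  also have "(m powr (1 / p)) powr p = m"
    using assms m by (simp add: powr_powr)
  finally show ?thesis
    using m assms(1) by (simp add: sobolev_norm_eq ennreal_less_iff)
qed

section \<open>Approximation by test functions\<close>

text \<open>As \<epsilon> runs through the positive reals, so does \<open>\<epsilon> powr p\<close>;
  hence smallness can be tested on the mass. From here on the norm itself is no longer used.\<close>

lemma sobolev_0_iff:
  assumes "0 < p"
  shows "u \<in> sobolev_0 \<sigma> p \<Omega> \<longleftrightarrow> u \<in> sobolev \<sigma> p \<Omega> \<and>
    (\<forall>e>0. \<exists>\<phi> \<in> test_functions \<Omega> \<inter> sobolev \<sigma> p \<Omega>. sobolev_mass \<sigma> p \<Omega> (\<lambda>x. u x - \<phi> x) < ennreal e)"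
    (is "?L \<longleftrightarrow> ?S \<and> ?R")
proof -
  have *: "?L \<longleftrightarrow> ?S \<and> (\<forall>\<epsilon>>0. \<exists>\<phi> \<in> test_functions \<Omega> \<inter> sobolev \<sigma> p \<Omega>.
      sobolev_mass \<sigma> p \<Omega> (\<lambda>x. u x - \<phi> x) < ennreal (\<epsilon> powr p))" (is "_ \<longleftrightarrow> ?S \<and> ?R'")
  proof -
    have "sobolev_norm \<sigma> p \<Omega> (\<lambda>x. u x - \<phi> x) < \<epsilon> \<longleftrightarrow>
        sobolev_mass \<sigma> p \<Omega> (\<lambda>x. u x - \<phi> x) < ennreal (\<epsilon> powr p)"
      if "?S" "\<epsilon> > 0" "\<phi> \<in> test_functions \<Omega> \<inter> sobolev \<sigma> p \<Omega>" for \<epsilon> \<phi>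
      using that assms by (intro sobolev_norm_less_iff sobolev_diff) auto
    then show ?thesis
      unfolding sobolev_0_def by (simp cong: conj_cong)
  qed
  have "?R' \<longleftrightarrow> ?R"
  proof
    assume R: ?R'
    show ?R
    proof (intro allI impI)
      fix e :: real assume "e > 0"
      then have "(e powr (1 / p)) powr p = e" "e powr (1 / p) > 0"
        using assms by (auto simp: powr_powr)
      then show "\<exists>\<phi> \<in> test_functions \<Omega> \<inter> sobolev \<sigma> p \<Omega>.
          sobolev_mass \<sigma> p \<Omega> (\<lambda>x. u x - \<phi> x) < ennreal e"
        using R by metis
    qed
  qed auto
  with * show ?thesis by simp
qed

text \<open>A closure is closed: first approximate by a member \<open>v\<close>, then
  \<open>v\<close> by a test function.\<close>

lemma sobolev_0_closed:
  assumes "0 < p" "u \<in> sobolev \<sigma> p \<Omega>"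
    and approx: "\<And>e. 0 < e \<Longrightarrow> \<exists>v \<in> sobolev_0 \<sigma> p \<Omega>. sobolev_mass \<sigma> p \<Omega> (\<lambda>x. u x - v x) < ennreal e"
  shows "u \<in> sobolev_0 \<sigma> p \<Omega>"
  unfolding sobolev_0_iff[OF \<open>0 < p\<close>]
proof (intro conjI allI impI)
  fix e :: real assume "e > 0"
  \<comment> \<open>Two errors below \<open>d\<close> are added and multiplied by
    \<open>2 powr p\<close>, which yields exactly \<open>e\<close>.\<close>
  define d where "d = e / (2 * 2 powr p)"
  have "d > 0" using \<open>e > 0\<close> by (simp add: d_def)
  obtain v where v: "v \<in> sobolev_0 \<sigma> p \<Omega>" "sobolev_mass \<sigma> p \<Omega> (\<lambda>x. u x - v x) < ennreal d"
    using approx[OF \<open>d > 0\<close>] by blast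
  obtain \<phi> where \<phi>: "\<phi> \<in> test_functions \<Omega> \<inter> sobolev \<sigma> p \<Omega>"
    "sobolev_mass \<sigma> p \<Omega> (\<lambda>x. v x - \<phi> x) < ennreal d"
    using v(1) \<open>d > 0\<close> \<open>0 < p\<close> by (auto simp: sobolev_0_iff)
  have [measurable]: "u \<in> borel_measurable (lebesgue_on \<Omega>)" "v \<in> borel_measurable (lebesgue_on \<Omega>)"
    "\<phi> \<in> borel_measurable (lebesgue_on \<Omega>)"
    using assms(2) v(1) \<phi>(1) \<open>0 < p\<close> by (auto simp: sobolev_iff sobolev_0_iff)
  have "sobolev_mass \<sigma> p \<Omega> (\<lambda>x. (u x - v x) + (v x - \<phi> x)) \<le> ennreal (2 powr p) *
      (sobolev_mass \<sigma> p \<Omega> (\<lambda>x. u x - v x) + sobolev_mass \<sigma> p \<Omega> (\<lambda>x. v x - \<phi> x))"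
    using \<open>0 < p\<close> by (intro sobolev_mass_add_le) auto
  also have "\<dots> < ennreal (2 powr p) * (ennreal d + ennreal d)"
    using v(2) \<phi>(2) by (intro ennreal_mult_strict_left_mono add_strict_mono) auto
  also have "\<dots> = ennreal e"
    using \<open>d > 0\<close> by (simp add: d_def flip: ennreal_plus ennreal_mult)
  finally show "\<exists>\<phi> \<in> test_functions \<Omega> \<inter> sobolev \<sigma> p \<Omega>.
      sobolev_mass \<sigma> p \<Omega> (\<lambda>x. u x - \<phi> x) < ennreal e"
    using \<phi>(1) by (intro bexI[of _ \<phi>]) simp_all
qed fact

section \<open>Comparison of different exponents\<close>

text \<open>For r > 0 the quotient of the two kernels is \<open>r powr (q' - q)\<close>, increasing
  in r. At r = 0 both sides vanish, because \<open>0 powr q = 0\<close> and division by 0 gives 0,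
  so the diagonal is included.\<close>

lemma divide_powr_le:
  fixes a r R q q' :: real
  assumes "0 \<le> a" "0 \<le> r" "r \<le> R" "q \<le> q'"
  shows "a / r powr q \<le> R powr (q' - q) * (a / r powr q')"
proof (cases "r = 0")
  case False
  then have "a / r powr q = r powr (q' - q) * (a / r powr q')"
    using assms by (simp add: powr_diff)
  also have "\<dots> \<le> R powr (q' - q) * (a / r powr q')"
    using assms by (intro mult_right_mono powr_mono2) auto
  finally show ?thesis .
qed simp

text \<open>The factor is kept explicit instead of being hidden in a constant, since
  \<open>energy_limsup\<close> needs it to tend to 1.\<close>

lemma gagliardo_mono_exponent:
  fixes \<Omega> :: "'a::euclidean_space set"
  assumes [measurable]: "u \<in> borel_measurable (lebesgue_on \<Omega>)"
    and R: "\<And>x y. x \<in> \<Omega> \<Longrightarrow> y \<in> \<Omega> \<Longrightarrow> norm (x - y) \<le> R" and "k \<le> \<sigma>" "0 < p"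
  shows "gagliardo k p \<Omega> u \<le> ennreal (R powr ((\<sigma> - k) * p)) * gagliardo \<sigma> p \<Omega> u"
proof -
  let ?P = "lebesgue_on \<Omega> \<Otimes>\<^sub>M lebesgue_on \<Omega>" and ?q = "\<lambda>\<sigma>. real DIM('a) + \<sigma> * p"
  let ?g = "\<lambda>\<sigma> (x, y). ennreal (\<bar>u x - u y\<bar> powr p / norm (x - y) powr ?q \<sigma>)"
  have "gagliardo k p \<Omega> u \<le> (\<integral>\<^sup>+ z. ennreal (R powr ((\<sigma> - k) * p)) * ?g \<sigma> z \<partial>?P)"
    unfolding gagliardo_def
  proof (intro nn_integral_mono, clarify)
    fix x y assume "(x, y) \<in> space ?P"
    then have "norm (x - y) \<le> R"
      by (intro R) (auto simp: space_pair_measure)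
    then have "\<bar>u x - u y\<bar> powr p / norm (x - y) powr ?q k \<le>
        R powr ((\<sigma> - k) * p) * (\<bar>u x - u y\<bar> powr p / norm (x - y) powr ?q \<sigma>)"
      using divide_powr_le[of "\<bar>u x - u y\<bar> powr p" "norm (x - y)" R "?q k" "?q \<sigma>"] assms
      by (simp add: algebra_simps)
    then show "ennreal (\<bar>u x - u y\<bar> powr p / norm (x - y) powr ?q k)
        \<le> ennreal (R powr ((\<sigma> - k) * p)) * ennreal (\<bar>u x - u y\<bar> powr p / norm (x - y) powr ?q \<sigma>)"
      by (simp flip: ennreal_mult)
  qed
  then show ?thesis
    unfolding gagliardo_def by (simp add: nn_integral_cmult)
qed

text \<open>Raising the diameter to at least 1 makes \<open>R powr ((\<sigma> - k) * p)\<close> at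
  least 1 for k \<le> \<sigma>, so that the same factor also covers the L^p part of the mass, and
  makes powers of \<open>R\<close> increase with the exponent.\<close>

lemma bounded_diameter_bound:
  fixes \<Omega> :: "'a::real_normed_vector set"
  assumes "bounded \<Omega>"
  obtains R :: real where "1 \<le> R" "\<And>x y. x \<in> \<Omega> \<Longrightarrow> y \<in> \<Omega> \<Longrightarrow> norm (x - y) \<le> R"
proof
  show "1 \<le> max 1 (diameter \<Omega>)" by simp
  show "norm (x - y) \<le> max 1 (diameter \<Omega>)" if "x \<in> \<Omega>" "y \<in> \<Omega>" for x y
    using diameter_bounded_bound[OF assms that] by (simp add: dist_norm)
qed

lemma sobolev_mass_mono_exponent:
  assumes "u \<in> borel_measurable (lebesgue_on \<Omega>)" "1 \<le> R"
    and "\<And>x y. x \<in> \<Omega> \<Longrightarrow> y \<in> \<Omega> \<Longrightarrow> norm (x - y) \<le> R" and "k \<le> \<sigma>" "0 < p"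
  shows "sobolev_mass k p \<Omega> u \<le> ennreal (R powr ((\<sigma> - k) * p)) * sobolev_mass \<sigma> p \<Omega> u"
proof -
  have "1 \<le> ennreal (R powr ((\<sigma> - k) * p))"
    using assms by (simp add: ge_one_powr_ge_zero)
  then have "(\<integral>\<^sup>+ x. ennreal (\<bar>u x\<bar> powr p) \<partial>lebesgue_on \<Omega>) \<le>
      ennreal (R powr ((\<sigma> - k) * p)) * (\<integral>\<^sup>+ x. ennreal (\<bar>u x\<bar> powr p) \<partial>lebesgue_on \<Omega>)"
    using mult_right_mono[of 1 "ennreal (R powr ((\<sigma> - k) * p))"] by simp
  then show ?thesis
    unfolding sobolev_mass_def distrib_left
    using gagliardo_mono_exponent[OF assms(1,3,4,5)] by (intro add_mono) auto
qed

lemma sobolev_mono_exponent: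
  assumes "bounded \<Omega>" "k \<le> \<sigma>" "0 < p"
  shows "sobolev \<sigma> p \<Omega> \<subseteq> sobolev k p \<Omega>"
proof
  fix u assume u: "u \<in> sobolev \<sigma> p \<Omega>"
  obtain R where R: "1 \<le> R" "\<And>x y. x \<in> \<Omega> \<Longrightarrow> y \<in> \<Omega> \<Longrightarrow> norm (x - y) \<le> R"
    using bounded_diameter_bound[OF assms(1)] by metis
  have "sobolev_mass k p \<Omega> u \<le> ennreal (R powr ((\<sigma> - k) * p)) * sobolev_mass \<sigma> p \<Omega> u"
    using u R assms by (intro sobolev_mass_mono_exponent) (auto simp: sobolev_iff)
  also have "\<dots> < \<infinity>"
    using u by (simp add: sobolev_iff ennreal_mult_less_top)
  finally show "u \<in> sobolev k p \<Omega>"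
    using u by (simp add: sobolev_iff)
qed

text \<open>The test functions that approximate at order \<sigma> also approximate at order k; the
  tolerance \<open>e / c\<close> absorbs the comparison factor \<open>c\<close>.\<close>

lemma sobolev_0_mono_exponent:
  assumes "bounded \<Omega>" "k \<le> \<sigma>" "0 < p"
  shows "sobolev_0 \<sigma> p \<Omega> \<subseteq> sobolev_0 k p \<Omega>"
proof
  fix u assume u: "u \<in> sobolev_0 \<sigma> p \<Omega>"
  obtain R where R: "1 \<le> R" "\<And>x y. x \<in> \<Omega> \<Longrightarrow> y \<in> \<Omega> \<Longrightarrow> norm (x - y) \<le> R"
    using bounded_diameter_bound[OF assms(1)] by metis
  define c where "c = R powr ((\<sigma> - k) * p)"
  have "c > 0" using R by (simp add: c_def)
  note mono = sobolev_mono_exponent[OF assms]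
  have us: "u \<in> sobolev \<sigma> p \<Omega>"
    using u assms by (simp add: sobolev_0_iff)
  show "u \<in> sobolev_0 k p \<Omega>"
    unfolding sobolev_0_iff[OF \<open>0 < p\<close>]
  proof (intro conjI allI impI)
    show "u \<in> sobolev k p \<Omega>" using us mono by blast
    fix e :: real assume "e > 0"
    then have "e / c > 0" using \<open>c > 0\<close> by simp
    then obtain \<phi> where \<phi>: "\<phi> \<in> test_functions \<Omega> \<inter> sobolev \<sigma> p \<Omega>"
      "sobolev_mass \<sigma> p \<Omega> (\<lambda>x. u x - \<phi> x) < ennreal (e / c)"
      using u unfolding sobolev_0_iff[OF \<open>0 < p\<close>] by blast
    have "sobolev_mass k p \<Omega> (\<lambda>x. u x - \<phi> x) \<le> ennreal c * sobolev_mass \<sigma> p \<Omega> (\<lambda>x. u x - \<phi> x)"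
      unfolding c_def using \<phi>(1) us R assms
      by (intro sobolev_mass_mono_exponent) (auto simp: sobolev_iff)
    also have "\<dots> < ennreal c * ennreal (e / c)"
      using \<phi>(2) \<open>c > 0\<close> by (intro ennreal_mult_strict_left_mono) auto
    also have "\<dots> = ennreal e"
      using \<open>c > 0\<close> \<open>e > 0\<close> by (simp flip: ennreal_mult)
    finally show "\<exists>\<phi> \<in> test_functions \<Omega> \<inter> sobolev k p \<Omega>.
        sobolev_mass k p \<Omega> (\<lambda>x. u x - \<phi> x) < ennreal e"
      using \<phi>(1) mono by blast
  qed
qed

lemma sobolev_0_subset_sobolev_0_minus:
  assumes "bounded \<Omega>" "0 < p"
  shows "sobolev_0 \<sigma> p \<Omega> \<subseteq> sobolev_0_minus \<sigma> p \<Omega>"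
proof -
  have "sobolev_0 \<sigma> p \<Omega> \<subseteq> sobolev \<sigma> p \<Omega>"
    unfolding sobolev_0_def by blast
  moreover have "sobolev_0 \<sigma> p \<Omega> \<subseteq> sobolev_0 k p \<Omega>" if "k \<in> {0<..<\<sigma>}" for k
    using that assms by (intro sobolev_0_mono_exponent) simp_all
  ultimately show ?thesis
    unfolding sobolev_0_minus_def by blast
qed

text \<open>This ordering lets two inequalities serve both \<Gamma>-limits: a liminf inequality for
  the smaller functionals passes to the larger ones, and a limsup inequality for the larger
  functionals passes to the smaller ones.\<close>

lemma energy_minus_le_energy:
  assumes "bounded \<Omega>" "0 < p"
  shows "energy_minus \<sigma> p \<Omega> u \<le> energy \<sigma> p \<Omega> u"
  using sobolev_0_subset_sobolev_0_minus[OF assms] by (auto simp: energy_def energy_minus_def)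

section \<open>Splitting the seminorm at a distance\<close>

lemma finite_measure_lebesgue_on_open_bounded:
  fixes \<Omega> :: "'a::euclidean_space set"
  assumes "open \<Omega>" "bounded \<Omega>"
  shows "finite_measure (lebesgue_on \<Omega>)"
  using assms by (intro finite_measure_lebesgue_on lmeasurable_open) auto

text \<open>Within distance \<delta> the ratio of the kernels is at most
  \<open>\<delta> powr ((k' - k) * p)\<close>. Beyond it the kernel of order k is at most
  \<open>1 / \<delta> powr (real DIM('a) + k * p)\<close>, and |w x - w y|^p is at most 2^p times
  the sum of two powers. Each of these depends on one variable only, so integrating the other one
  gives the measure of \<Omega>; the two terms account for the leading 2.\<close>

lemma gagliardo_interpolation:
  fixes \<Omega> :: "'a::euclidean_space set"
  assumes "open \<Omega>" "bounded \<Omega>" and [measurable]: "w \<in> borel_measurable (lebesgue_on \<Omega>)"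
    and "0 \<le> k" "k \<le> k'" "0 < p" "0 < \<delta>"
  shows "gagliardo k p \<Omega> w \<le> ennreal (\<delta> powr ((k' - k) * p)) * gagliardo k' p \<Omega> w
    + ennreal (2 * 2 powr p / \<delta> powr (real DIM('a) + k * p)) * emeasure lebesgue \<Omega>
      * (\<integral>\<^sup>+ x. ennreal (\<bar>w x\<bar> powr p) \<partial>lebesgue_on \<Omega>)"
proof -
  let ?M = "lebesgue_on \<Omega>" and ?q = "\<lambda>\<sigma>. real DIM('a) + \<sigma> * p"
  let ?P = "?M \<Otimes>\<^sub>M ?M"
  let ?g = "\<lambda>\<sigma> (x, y). ennreal (\<bar>w x - w y\<bar> powr p / norm (x - y) powr ?q \<sigma>)"
  let ?f = "\<lambda>x. ennreal (\<bar>w x\<bar> powr p)"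
  define a where "a = \<delta> powr ((k' - k) * p)"
  define b where "b = 2 powr p / \<delta> powr ?q k"
  interpret M: finite_measure ?M
    by (rule finite_measure_lebesgue_on_open_bounded) fact+
  interpret P: pair_sigma_finite ?M ?M ..
  have \<Omega>: "emeasure ?M \<Omega> = emeasure lebesgue \<Omega>"
    using assms(1) by (simp add: emeasure_restrict_space)
  have pointwise: "?g k (x, y) \<le> ennreal a * ?g k' (x, y) + ennreal b * (?f x + ?f y)" for x y
  proof -
    define A where "A = \<bar>w x - w y\<bar> powr p"
    have A: "0 \<le> A" "A \<le> 2 powr p * (\<bar>w x\<bar> powr p + \<bar>w y\<bar> powr p)"
      using abs_add_powr_le[of p "w x" "- w y"] \<open>0 < p\<close> by (auto simp: A_def)
    \<comment> \<open>Both bounds are added at every point, the unneeded one being nonnegative. This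
      avoids cutting the domain of integration.\<close>
    have "A / norm (x - y) powr ?q k \<le>
        a * (A / norm (x - y) powr ?q k') + b * (\<bar>w x\<bar> powr p + \<bar>w y\<bar> powr p)"
    proof (cases "norm (x - y) \<le> \<delta>")
      case True
      then have "A / norm (x - y) powr ?q k \<le> a * (A / norm (x - y) powr ?q k')"
        using divide_powr_le[of A "norm (x - y)" \<delta> "?q k" "?q k'"] A assms
        by (simp add: a_def algebra_simps)
      moreover have "0 \<le> b * (\<bar>w x\<bar> powr p + \<bar>w y\<bar> powr p)"
        by (simp add: b_def)
      ultimately show ?thesis by linarith
    next
      case False
      then have "A / norm (x - y) powr ?q k \<le> A / \<delta> powr ?q k"
        using assms A by (intro divide_left_mono powr_mono2 mult_pos_pos) auto
      also have "\<dots> \<le> 2 powr p * (\<bar>w x\<bar> powr p + \<bar>w y\<bar> powr p) / \<delta> powr ?q k"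
        using A by (intro divide_right_mono) auto
      also have "\<dots> = b * (\<bar>w x\<bar> powr p + \<bar>w y\<bar> powr p)"
        by (simp add: b_def)
      moreover have "0 \<le> a * (A / norm (x - y) powr ?q k')"
        using A by (simp add: a_def)
      ultimately show ?thesis by linarith
    qed
    then show ?thesis
      by (simp add: A_def a_def b_def flip: ennreal_plus ennreal_mult)
  qed
  have "gagliardo k p \<Omega> w \<le> (\<integral>\<^sup>+ z. ennreal a * ?g k' z + ennreal b * (?f (fst z) + ?f (snd z)) \<partial>?P)"
    unfolding gagliardo_def using pointwise by (intro nn_integral_mono) (auto split: prod.split)
  also have "\<dots> = ennreal a * (\<integral>\<^sup>+ z. ?g k' z \<partial>?P)
      + ennreal b * ((\<integral>\<^sup>+ z. ?f (fst z) \<partial>?P) + (\<integral>\<^sup>+ z. ?f (snd z) \<partial>?P))"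
    by (simp add: nn_integral_cmult nn_integral_add)
  also have "(\<integral>\<^sup>+ z. ?f (fst z) \<partial>?P) = emeasure lebesgue \<Omega> * (\<integral>\<^sup>+ x. ?f x \<partial>?M)"
    by (simp add: M.nn_integral_fst[symmetric] nn_integral_cmult \<Omega> mult.commute)
  also have "(\<integral>\<^sup>+ z. ?f (snd z) \<partial>?P) = emeasure lebesgue \<Omega> * (\<integral>\<^sup>+ x. ?f x \<partial>?M)"
    by (simp add: M.nn_integral_fst[symmetric] \<Omega> mult.commute)
  also have "ennreal b * (emeasure lebesgue \<Omega> * (\<integral>\<^sup>+ x. ?f x \<partial>?M) + emeasure lebesgue \<Omega> * (\<integral>\<^sup>+ x. ?f x \<partial>?M))
      = (ennreal b + ennreal b) * emeasure lebesgue \<Omega> * (\<integral>\<^sup>+ x. ?f x \<partial>?M)"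
    by (simp add: algebra_simps)
  also have "ennreal b + ennreal b = ennreal (2 * 2 powr p / \<delta> powr ?q k)"
    by (simp add: b_def flip: ennreal_plus)
  finally show ?thesis
    by (simp add: gagliardo_def a_def)
qed

section \<open>L^p convergence and almost everywhere convergence\<close>

lemma Lp_diff_powr_integrable:
  assumes "u \<in> Lp p \<Omega>" "v \<in> Lp p \<Omega>" "0 \<le> p"
  shows "integrable (lebesgue_on \<Omega>) (\<lambda>x. \<bar>u x - v x\<bar> powr p)"
proof -
  have [measurable]: "u \<in> borel_measurable (lebesgue_on \<Omega>)" "v \<in> borel_measurable (lebesgue_on \<Omega>)"
    and int: "integrable (lebesgue_on \<Omega>) (\<lambda>x. \<bar>u x\<bar> powr p)"
      "integrable (lebesgue_on \<Omega>) (\<lambda>x. \<bar>v x\<bar> powr p)"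
    using assms by (auto simp: Lp_def)
  show ?thesis
  proof (rule Bochner_Integration.integrable_bound)
    show "integrable (lebesgue_on \<Omega>) (\<lambda>x. 2 powr p * (\<bar>u x\<bar> powr p + \<bar>v x\<bar> powr p))"
      using int by (intro integrable_mult_right Bochner_Integration.integrable_add)
    show "AE x in lebesgue_on \<Omega>. norm (\<bar>u x - v x\<bar> powr p)
        \<le> norm (2 powr p * (\<bar>u x\<bar> powr p + \<bar>v x\<bar> powr p))"
    proof (rule AE_I2)
      fix x
      show "norm (\<bar>u x - v x\<bar> powr p) \<le> norm (2 powr p * (\<bar>u x\<bar> powr p + \<bar>v x\<bar> powr p))"
        using abs_add_powr_le[OF \<open>0 \<le> p\<close>, of "u x" "- v x"] by simp
    qed
    show "(\<lambda>x. \<bar>u x - v x\<bar> powr p) \<in> borel_measurable (lebesgue_on \<Omega>)"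
      by measurable
  qed
qed

lemma Lp_dist_tendsto_0D:
  assumes "(\<lambda>n. Lp_dist p \<Omega> (v n) u) \<longlonglongrightarrow> 0" "0 < p"
  shows "(\<lambda>n. LINT x|lebesgue_on \<Omega>. \<bar>v n x - u x\<bar> powr p) \<longlonglongrightarrow> 0"
proof -
  have "(Lp_dist p \<Omega> (v n) u) powr p = (LINT x|lebesgue_on \<Omega>. \<bar>v n x - u x\<bar> powr p)" for n
    using \<open>0 < p\<close> by (simp add: Lp_dist_def Lp_norm_def powr_powr)
  moreover have "(\<lambda>n. (Lp_dist p \<Omega> (v n) u) powr p) \<longlonglongrightarrow> 0"
    using assms by (intro tendsto_zero_powrI[OF _ tendsto_const])
      (auto simp: Lp_dist_def Lp_norm_def)
  ultimately show ?thesis by simp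
qed

text \<open>The functions |v n - u|^p tend to 0 in L^1, so a subsequence does so almost everywhere;
  taking p-th roots pointwise gives the claim.\<close>

lemma Lp_tendsto_AE_subseq:
  assumes "u \<in> Lp p \<Omega>" "\<And>n. v n \<in> Lp p \<Omega>" "0 < p"
    and lim: "(\<lambda>n. LINT x|lebesgue_on \<Omega>. \<bar>v n x - u x\<bar> powr p) \<longlonglongrightarrow> 0"
  obtains r :: "nat \<Rightarrow> nat" where "strict_mono r"
    "AE x in lebesgue_on \<Omega>. (\<lambda>n. v (r n) x) \<longlonglongrightarrow> u x"
proof -
  obtain r :: "nat \<Rightarrow> nat" where "strict_mono r"
    and ae: "AE x in lebesgue_on \<Omega>. (\<lambda>n. \<bar>v (r n) x - u x\<bar> powr p) \<longlonglongrightarrow> 0"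
    using tendsto_L1_AE_subseq[of "lebesgue_on \<Omega>" "\<lambda>n x. \<bar>v n x - u x\<bar> powr p"]
      Lp_diff_powr_integrable[OF assms(2,1)] lim \<open>0 < p\<close> by auto
  have "(\<lambda>n. a n) \<longlonglongrightarrow> b" if "(\<lambda>n. \<bar>a n - b\<bar> powr p) \<longlonglongrightarrow> 0" for a :: "nat \<Rightarrow> real" and b
  proof -
    have "(\<lambda>n. (\<bar>a n - b\<bar> powr p) powr (1 / p)) \<longlonglongrightarrow> 0"
      using that \<open>0 < p\<close> by - (rule tendsto_zero_powrI[OF _ tendsto_const], auto)
    then have "(\<lambda>n. \<bar>a n - b\<bar>) \<longlonglongrightarrow> 0"
      using \<open>0 < p\<close> by (simp add: powr_powr)
    then show ?thesis
      using LIM_zero_iff tendsto_rabs_zero_iff by blast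
  qed
  with ae have "AE x in lebesgue_on \<Omega>. (\<lambda>n. v (r n) x) \<longlonglongrightarrow> u x"
    by (auto elim!: eventually_mono)
  with \<open>strict_mono r\<close> show ?thesis by (rule that)
qed

text \<open>The bad pairs lie in \<open>A \<times> space M2 \<union> space M1 \<times> B\<close>
  with null sets \<open>A\<close> and \<open>B\<close>, a union of two null strips. It turns almost
  everywhere convergence of functions into that of the integrands of the double integral.\<close>

lemma (in pair_sigma_finite) AE_pair_measure_both:
  assumes "AE x in M1. P x" "AE y in M2. Q y"
  shows "AE (x, y) in M1 \<Otimes>\<^sub>M M2. P x \<and> Q y"
proof -
  obtain A where A: "{x \<in> space M1. \<not> P x} \<subseteq> A" "A \<in> null_sets M1"
    using assms(1) by (auto elim!: AE_E simp: null_sets_def)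
  obtain B where B: "{y \<in> space M2. \<not> Q y} \<subseteq> B" "B \<in> null_sets M2"
    using assms(2) by (auto elim!: AE_E simp: null_sets_def)
  have "A \<times> space M2 \<union> space M1 \<times> B \<in> null_sets (M1 \<Otimes>\<^sub>M M2)"
    using A B by (intro null_sets.Un M2.times_in_null_sets1 M2.times_in_null_sets2) auto
  then show ?thesis
    using A B by (intro AE_I') (auto simp: space_pair_measure)
qed

section \<open>Lower semicontinuity and the space of the limit\<close>

lemma gagliardo_Fatou:
  fixes \<Omega> :: "'a::euclidean_space set"
  assumes "open \<Omega>" "bounded \<Omega>" "0 < p"
    and [measurable]: "u \<in> borel_measurable (lebesgue_on \<Omega>)" "\<And>n. w n \<in> borel_measurable (lebesgue_on \<Omega>)"
    and ae: "AE x in lebesgue_on \<Omega>. (\<lambda>n. w n x) \<longlonglongrightarrow> u x"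
    and \<tau>: "\<tau> \<longlonglongrightarrow> s"
  shows "gagliardo s p \<Omega> u \<le> liminf (\<lambda>n. gagliardo (\<tau> n) p \<Omega> (w n))"
proof -
  let ?M = "lebesgue_on \<Omega>"
  let ?g = "\<lambda>\<sigma> u (x, y). ennreal (\<bar>u x - u y\<bar> powr p / norm (x - y) powr (real DIM('a) + \<sigma> * p))"
  interpret M: finite_measure ?M
    by (rule finite_measure_lebesgue_on_open_bounded) fact+
  interpret P: pair_sigma_finite ?M ?M ..
  have "AE z in ?M \<Otimes>\<^sub>M ?M. (\<lambda>n. ?g (\<tau> n) (w n) z) \<longlonglongrightarrow> ?g s u z"
    using P.AE_pair_measure_both[OF ae ae]
  proof (rule eventually_mono)
    fix z assume *: "case z of (x, y) \<Rightarrow> (\<lambda>n. w n x) \<longlonglongrightarrow> u x \<and> (\<lambda>n. w n y) \<longlonglongrightarrow> u y"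
    obtain x y where z: "z = (x, y)" by (cases z)
    have w: "(\<lambda>n. w n x) \<longlonglongrightarrow> u x" "(\<lambda>n. w n y) \<longlonglongrightarrow> u y"
      using * z by auto
    show "(\<lambda>n. ?g (\<tau> n) (w n) z) \<longlonglongrightarrow> ?g s u z"
    \<comment> \<open>On the diagonal every integrand is 0 / 0 = 0; off it
      \<open>norm (x - y)\<close> is positive, which makes the kernel continuous in the
      exponent.\<close>
    proof (cases "x = y")
      case False
      \<comment> \<open>The base may tend to 0, so continuity of the power relies on p > 0.\<close>
      have "(\<lambda>n. \<bar>w n x - w n y\<bar> powr p) \<longlonglongrightarrow> \<bar>u x - u y\<bar> powr p"
        using w \<open>0 < p\<close> by (intro tendsto_powr2 tendsto_intros) auto
      then show ?thesis
        using False \<tau> unfolding z by (auto intro!: tendsto_intros)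
    qed (simp add: z)
  qed
  then have "AE z in ?M \<Otimes>\<^sub>M ?M. ?g s u z = liminf (\<lambda>n. ?g (\<tau> n) (w n) z)"
    by (rule eventually_mono) (simp add: lim_imp_Liminf)
  then have "gagliardo s p \<Omega> u = (\<integral>\<^sup>+ z. liminf (\<lambda>n. ?g (\<tau> n) (w n) z) \<partial>(?M \<Otimes>\<^sub>M ?M))"
    unfolding gagliardo_def by (rule nn_integral_cong_AE)
  also have "\<dots> \<le> liminf (\<lambda>n. gagliardo (\<tau> n) p \<Omega> (w n))"
    unfolding gagliardo_def by (intro nn_integral_liminf) measurable
  finally show ?thesis .
qed

text \<open>The bound on the seminorm of \<open>u\<close> is supplied by
  \<open>gagliardo_Fatou\<close>. What remains is to show, for each k < s, that some
  \<open>w n\<close> lying in \<open>sobolev_0 k p \<Omega>\<close> is as close to \<open>u\<close>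
  at order k as desired.\<close>

lemma sobolev_0_minus_limit:
  fixes \<Omega> :: "'a::euclidean_space set"
  assumes "open \<Omega>" "bounded \<Omega>" "0 < p" "u \<in> Lp p \<Omega>"
    and w: "\<And>n. w n \<in> sobolev_0_minus (\<tau> n) p \<Omega>"
    and lim: "(\<lambda>n. LINT x|lebesgue_on \<Omega>. \<bar>w n x - u x\<bar> powr p) \<longlonglongrightarrow> 0"
    and \<tau>: "\<tau> \<longlonglongrightarrow> s" "\<And>n. \<tau> n \<le> s"
    and L: "\<And>n. gagliardo (\<tau> n) p \<Omega> (w n) \<le> L" "gagliardo s p \<Omega> u \<le> L" "L < \<infinity>"
  shows "u \<in> sobolev_0_minus s p \<Omega>"
proof -
  let ?I = "\<lambda>n. \<integral>\<^sup>+ x. ennreal (\<bar>w n x - u x\<bar> powr p) \<partial>lebesgue_on \<Omega>"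
  have wLp: "w n \<in> Lp p \<Omega>" for n
    using w[of n] by (simp add: sobolev_0_minus_def sobolev_def)
  have [measurable]: "u \<in> borel_measurable (lebesgue_on \<Omega>)" "w n \<in> borel_measurable (lebesgue_on \<Omega>)" for n
    using assms(4) wLp by (auto simp: Lp_def)
  have us: "u \<in> sobolev s p \<Omega>"
    using assms(4) L by (auto simp: sobolev_def)
  have "?I n = ennreal (LINT x|lebesgue_on \<Omega>. \<bar>w n x - u x\<bar> powr p)" for n
    using Lp_diff_powr_integrable[OF wLp assms(4)] \<open>0 < p\<close> by (intro nn_integral_eq_integral) auto
  then have I: "?I \<longlonglongrightarrow> 0"
    using tendsto_ennrealI[OF lim] by simp
  obtain R where R: "1 \<le> R" "\<And>x y. x \<in> \<Omega> \<Longrightarrow> y \<in> \<Omega> \<Longrightarrow> norm (x - y) \<le> R"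
    using bounded_diameter_bound[OF assms(2)] by metis
  have "u \<in> sobolev_0 k p \<Omega>" if "0 < k" "k < s" for k
  proof (rule sobolev_0_closed[OF \<open>0 < p\<close>])
    show "u \<in> sobolev k p \<Omega>"
      using us sobolev_mono_exponent[of \<Omega> k s p] assms that by auto
    fix e :: real assume "0 < e"
    \<comment> \<open>The gap between k and k' yields the small factor, the gap between k' and s
      makes the seminorms of order k' bounded.\<close>
    obtain k' where k': "k < k'" "k' < s"
      using dense[OF \<open>k < s\<close>] by blast
    define B where "B = ennreal (2 powr p) * (ennreal (R powr ((s - k') * p)) * L + ennreal (R powr ((s - k') * p)) * L)"
    \<comment> \<open>Orders \<open>t\<close> between k' and s are reduced to the fixed order k'.
      Since R \<ge> 1 and t \<le> s, the factor for \<open>t\<close> is at most the one for s, so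
      the bound does not depend on n.\<close>
    have bound: "gagliardo k' p \<Omega> v \<le> ennreal (R powr ((s - k') * p)) * L"
      if "k' \<le> t" "t \<le> s" "gagliardo t p \<Omega> v \<le> L" and [measurable]: "v \<in> borel_measurable (lebesgue_on \<Omega>)"
      for t v
    proof -
      have "gagliardo k' p \<Omega> v \<le> ennreal (R powr ((t - k') * p)) * gagliardo t p \<Omega> v"
        using that R \<open>0 < p\<close> by (intro gagliardo_mono_exponent) auto
      also have "\<dots> \<le> ennreal (R powr ((s - k') * p)) * L"
        using that R \<open>0 < p\<close> by (intro mult_mono ennreal_leI powr_mono mult_right_mono) auto
      finally show ?thesis .
    qed
    have B: "gagliardo k' p \<Omega> (\<lambda>x. w n x - u x) \<le> B" if "k' < \<tau> n" for n
    proof -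
      have "gagliardo k' p \<Omega> (\<lambda>x. w n x + - u x) \<le>
          ennreal (2 powr p) * (gagliardo k' p \<Omega> (w n) + gagliardo k' p \<Omega> (\<lambda>x. - u x))"
        using \<open>0 < p\<close> by (intro gagliardo_add_le) auto
      also have "\<dots> \<le> B"
        unfolding B_def gagliardo_uminus using that k' \<tau>(2)[of n] L
        by (intro mult_left_mono add_mono bound) auto
      finally show ?thesis by simp
    qed
    have "B < \<infinity>"
      using L(3) by (simp add: B_def ennreal_mult_less_top)
    then obtain b where b: "0 \<le> b" "B = ennreal b"
      by (cases B) auto
    \<comment> \<open>Makes the short-range factor equal to \<open>e / (2 * (b + 1))\<close>, whose
      product with \<open>b\<close> is below \<open>e / 2\<close>; the summand 1 allows b =
      0.\<close>
    define \<delta> where "\<delta> = (e / (2 * (b + 1))) powr (1 / ((k' - k) * p))"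
    have \<delta>: "0 < \<delta>" "\<delta> powr ((k' - k) * p) = e / (2 * (b + 1))"
      using \<open>0 < e\<close> b k' \<open>0 < p\<close> by (simp_all add: \<delta>_def powr_powr)
    \<comment> \<open>The long-range constant depends on \<delta> but not on n. With \<delta> fixed,
      n is chosen so large that \<open>(1 + c) * ?I n\<close> is below \<open>e / 2\<close>; the 1
      stands for the L^p part of the mass.\<close>
    define c where "c = ennreal (2 * 2 powr p / \<delta> powr (real DIM('a) + k * p)) * emeasure lebesgue \<Omega>"
    have "c < \<infinity>"
      using assms(1,2) lmeasurable_open[of \<Omega>] by (auto simp: c_def ennreal_mult_less_top fmeasurable_def)
    then have "(\<lambda>n. (1 + c) * ?I n) \<longlonglongrightarrow> (1 + c) * 0"
      by (intro ennreal_tendsto_cmult I) simp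
    then have "\<forall>\<^sub>F n in sequentially. (1 + c) * ?I n < ennreal (e / 2)"
      using \<open>0 < e\<close> by (intro order_tendstoD(2)) auto
    moreover have "\<forall>\<^sub>F n in sequentially. k' < \<tau> n"
      using \<tau>(1) k' by (intro order_tendstoD(1))
    ultimately obtain n where n: "(1 + c) * ?I n < ennreal (e / 2)" "k' < \<tau> n"
      by (metis (mono_tags, lifting) eventually_conj eventually_happens' sequentially_bot)
    have "sobolev_mass k p \<Omega> (\<lambda>x. u x - w n x) = sobolev_mass k p \<Omega> (\<lambda>x. w n x - u x)"
      using sobolev_mass_uminus[of k p \<Omega> "\<lambda>x. w n x - u x"] by simp
    also have "\<dots> \<le> ?I n + (ennreal (\<delta> powr ((k' - k) * p)) * gagliardo k' p \<Omega> (\<lambda>x. w n x - u x) + c * ?I n)"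
      unfolding sobolev_mass_def c_def using assms that k' \<delta>
      by (intro add_left_mono gagliardo_interpolation) auto
    also have "\<dots> \<le> ?I n + (ennreal (\<delta> powr ((k' - k) * p)) * B + c * ?I n)"
      by (intro add_left_mono add_right_mono mult_left_mono B n) simp
    also have "\<dots> = (1 + c) * ?I n + ennreal (e / (2 * (b + 1)) * b)"
      using \<delta> b \<open>0 < e\<close> by (simp add: algebra_simps flip: ennreal_mult)
    also have "\<dots> < ennreal (e / 2) + ennreal (e / 2)"
    proof (rule add_strict_mono[OF n(1)])
      have "e / (2 * (b + 1)) * b < e / 2"
        using \<open>0 < e\<close> b by (simp add: field_simps)
      then show "ennreal (e / (2 * (b + 1)) * b) < ennreal (e / 2)"
        using \<open>0 < e\<close> by (intro ennreal_lessI) auto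
    qed
    also have "\<dots> = ennreal e"
      using \<open>0 < e\<close> by (simp flip: ennreal_plus)
    finally have "sobolev_mass k p \<Omega> (\<lambda>x. u x - w n x) < ennreal e" .
    \<comment> \<open>Holds because k < k' < \<open>\<tau> n\<close>, by the choice of n.\<close>
    moreover have "w n \<in> sobolev_0 k p \<Omega>"
      using w[of n] n(2) that k' by (auto simp: sobolev_0_minus_def)
    ultimately show "\<exists>v\<in>sobolev_0 k p \<Omega>. sobolev_mass k p \<Omega> (\<lambda>x. u x - v x) < ennreal e"
      by blast
  qed
  with us show ?thesis
    by (auto simp: sobolev_0_minus_def)
qed

section \<open>The liminf and limsup inequalities\<close>

lemma energy_minus_liminf:
  fixes \<Omega> :: "'a::euclidean_space set"
  assumes "open \<Omega>" "bounded \<Omega>" "0 < p" "u \<in> Lp p \<Omega>" "\<And>n. v n \<in> Lp p \<Omega>"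
    and lim: "(\<lambda>n. Lp_dist p \<Omega> (v n) u) \<longlonglongrightarrow> 0"
    and \<sigma>: "\<sigma> \<longlonglongrightarrow> s" "\<And>n. \<sigma> n \<le> s"
  shows "energy_minus s p \<Omega> u \<le> liminf (\<lambda>n. energy_minus (\<sigma> n) p \<Omega> (v n))"
  unfolding le_Liminf_iff
proof (intro allI impI, rule ccontr)
  fix y assume y: "y < energy_minus s p \<Omega> u"
    and "\<not> (\<forall>\<^sub>F n in sequentially. y < energy_minus (\<sigma> n) p \<Omega> (v n))"
  \<comment> \<open>If the inequality fails, the energies stay below some y < E(u) infinitely often.
    Two extractions follow: \<open>q\<close> keeps this energy bound, \<open>r\<close> adds almost
    everywhere convergence.\<close>
  then have "\<exists>\<^sub>F n in sequentially. energy_minus (\<sigma> n) p \<Omega> (v n) \<le> y"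
    by (simp add: frequently_def not_le)
  then have "infinite {n. energy_minus (\<sigma> n) p \<Omega> (v n) \<le> y}"
    by (simp add: frequently_cofinite flip: cofinite_eq_sequentially)
  then obtain q :: "nat \<Rightarrow> nat" where q: "strict_mono q" "\<And>n. energy_minus (\<sigma> (q n)) p \<Omega> (v (q n)) \<le> y"
    using infinite_enumerate by blast
  have lim': "(\<lambda>n. LINT x|lebesgue_on \<Omega>. \<bar>v n x - u x\<bar> powr p) \<longlonglongrightarrow> 0"
    using Lp_dist_tendsto_0D[OF lim \<open>0 < p\<close>] .
  obtain r :: "nat \<Rightarrow> nat" where r: "strict_mono r"
    and ae: "AE x in lebesgue_on \<Omega>. (\<lambda>n. v (q (r n)) x) \<longlonglongrightarrow> u x"
    using Lp_tendsto_AE_subseq[of u p \<Omega> "\<lambda>n. v (q n)"] assms(3,4,5)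
      LIMSEQ_subseq_LIMSEQ[OF lim' q(1)] by (auto simp: o_def)
  define \<tau> where "\<tau> n = \<sigma> (q (r n))" for n
  define w where "w n = v (q (r n))" for n
  define L where "L = e2ennreal y"
  have qr: "strict_mono (q \<circ> r)"
    using q(1) r by (rule strict_mono_o)
  have limw: "(\<lambda>n. LINT x|lebesgue_on \<Omega>. \<bar>w n x - u x\<bar> powr p) \<longlonglongrightarrow> 0"
    using LIMSEQ_subseq_LIMSEQ[OF lim' qr] by (simp add: o_def w_def)
  have \<tau>: "\<tau> \<longlonglongrightarrow> s" "\<And>n. \<tau> n \<le> s"
    using LIMSEQ_subseq_LIMSEQ[OF \<sigma>(1) qr] \<sigma>(2) by (simp_all add: o_def \<tau>_def[abs_def])
  have "y < \<infinity>" using y by (metis ereal_infty_less(1) less_le_trans top_greatest top_ereal_def order_less_irrefl)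
  \<comment> \<open>Outside the space the energy is \<infinity>, so a finite bound \<open>y\<close>
    forces membership.\<close>
  have le: "w n \<in> sobolev_0_minus (\<tau> n) p \<Omega>" "enn2ereal (gagliardo (\<tau> n) p \<Omega> (w n)) \<le> y" for n
    using q(2)[of "r n"] \<open>y < \<infinity>\<close> by (auto simp: energy_minus_def \<tau>_def w_def split: if_splits)
  \<comment> \<open>Needed for \<open>L\<close> to represent \<open>y\<close> faithfully, since
    \<open>e2ennreal\<close> sends negative values to 0.\<close>
  have "0 \<le> y"
    using le(2)[of 0] enn2ereal_nonneg order_trans by blast
  then have yL: "enn2ereal L = y"
    by (simp add: L_def enn2ereal_e2ennreal)
  then have L: "gagliardo (\<tau> n) p \<Omega> (w n) \<le> L" for n
    using le(2)[of n] by (simp add: less_eq_ennreal.rep_eq)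
  have "L < \<infinity>"
    using yL \<open>y < \<infinity>\<close> by (metis enn2ereal_top infinity_ennreal_def less_top order_less_irrefl)
  have [measurable]: "u \<in> borel_measurable (lebesgue_on \<Omega>)" "w n \<in> borel_measurable (lebesgue_on \<Omega>)" for n
    using assms(4,5) by (auto simp: Lp_def w_def)
  have "gagliardo s p \<Omega> u \<le> liminf (\<lambda>n. gagliardo (\<tau> n) p \<Omega> (w n))"
    using ae[folded w_def] by (intro gagliardo_Fatou assms(1-3) \<tau>(1)) auto
  also have "\<dots> \<le> limsup (\<lambda>n. L)"
    using L by (intro order_trans[OF Liminf_le_Limsup Limsup_mono]) auto
  finally have G: "gagliardo s p \<Omega> u \<le> L"
    by (simp add: Limsup_const)
  have "u \<in> sobolev_0_minus s p \<Omega>"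
    by (rule sobolev_0_minus_limit[OF assms(1-4) le(1) limw \<tau> L G \<open>L < \<infinity>\<close>])
  then have "energy_minus s p \<Omega> u \<le> y"
    using G yL by (simp add: energy_minus_def less_eq_ennreal.rep_eq)
  with y show False by simp
qed

text \<open>Strictness of \<open>\<sigma> n < s\<close> is essential: it puts every member of
  \<open>sobolev_0_minus s p \<Omega>\<close> into \<open>sobolev_0 (\<sigma> n) p \<Omega>\<close>,
  so even the larger functionals are finite at \<open>u\<close>.\<close>

lemma energy_limsup:
  fixes \<Omega> :: "'a::euclidean_space set"
  assumes "bounded \<Omega>" "0 < p" "u \<in> Lp p \<Omega>"
    and \<sigma>: "\<sigma> \<longlonglongrightarrow> s" "\<And>n. 0 < \<sigma> n" "\<And>n. \<sigma> n < s"
  shows "limsup (\<lambda>n. energy (\<sigma> n) p \<Omega> u) \<le> energy_minus s p \<Omega> u"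
proof (cases "u \<in> sobolev_0_minus s p \<Omega>")
  case True
  obtain R where R: "1 \<le> R" "\<And>x y. x \<in> \<Omega> \<Longrightarrow> y \<in> \<Omega> \<Longrightarrow> norm (x - y) \<le> R"
    using bounded_diameter_bound[OF assms(1)] by metis
  let ?G = "gagliardo s p \<Omega> u"
  have "?G < \<infinity>"
    using True by (simp add: sobolev_0_minus_def sobolev_def)
  have "energy (\<sigma> n) p \<Omega> u \<le> enn2ereal (?G * ennreal (R powr ((s - \<sigma> n) * p)))" for n
  proof -
    have "u \<in> sobolev_0 (\<sigma> n) p \<Omega>"
      using True \<sigma>(2,3) by (auto simp: sobolev_0_minus_def)
    moreover have "gagliardo (\<sigma> n) p \<Omega> u \<le> ?G * ennreal (R powr ((s - \<sigma> n) * p))"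
      using assms(2,3) \<sigma>(3)[of n] R
      by (subst mult.commute, intro gagliardo_mono_exponent) (auto simp: Lp_def)
    ultimately show ?thesis
      by (simp add: energy_def less_eq_ennreal.rep_eq)
  qed
  then have "limsup (\<lambda>n. energy (\<sigma> n) p \<Omega> u) \<le>
      limsup (\<lambda>n. enn2ereal (?G * ennreal (R powr ((s - \<sigma> n) * p))))"
    by (intro Limsup_mono) auto
  \<comment> \<open>The exponent tends to 0 and R > 0, so the factor tends to
    \<open>R powr 0 = 1\<close>; finiteness of \<open>?G\<close> justifies multiplying the limit in
    \<open>ennreal\<close>.\<close>
  also have "(\<lambda>n. enn2ereal (?G * ennreal (R powr ((s - \<sigma> n) * p)))) \<longlonglongrightarrow>
      enn2ereal (?G * ennreal (R powr ((s - s) * p)))"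
    using \<open>?G < \<infinity>\<close> R(1)
    by (intro tendsto_enn2erealI ennreal_tendsto_cmult tendsto_ennrealI tendsto_intros \<sigma>(1)) auto
  then have "limsup (\<lambda>n. enn2ereal (?G * ennreal (R powr ((s - \<sigma> n) * p)))) = enn2ereal ?G"
    using R(1) by (intro lim_imp_Limsup) auto
  finally show ?thesis
    using True by (simp add: energy_minus_def)
qed (simp add: energy_minus_def)

section \<open>Assembling the \<Gamma>-limits\<close>

lemma Gamma_converges_constant_recoveryI:
  assumes "\<And>u v. u \<in> X \<Longrightarrow> (\<And>n. v n \<in> X) \<Longrightarrow> (\<lambda>n. d (v n) u) \<longlonglongrightarrow> 0 \<Longrightarrow> E u \<le> liminf (\<lambda>n. F n (v n))"
    and "\<And>u. u \<in> X \<Longrightarrow> d u u = 0"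
    and "\<And>u. u \<in> X \<Longrightarrow> limsup (\<lambda>n. F n u) \<le> E u"
  shows "Gamma_converges X d F E"
  unfolding Gamma_converges_def
proof (intro conjI ballI)
  fix u assume "u \<in> X"
  then show "\<exists>v. (\<forall>n. v n \<in> X) \<and> (\<lambda>n. d (v n) u) \<longlonglongrightarrow> 0 \<and> limsup (\<lambda>n. F n (v n)) \<le> E u"
    using assms(2,3) by (intro exI[of _ "\<lambda>_. u"]) simp
qed (use assms(1) in blast)

theorem theorem3p2:
  fixes \<Omega> :: "'a::euclidean_space set" and s p :: real and \<sigma> :: "nat \<Rightarrow> real"
  assumes "0 < s" "s < 1" and "1 < p"
    and "open \<Omega>" "bounded \<Omega>"
    and "\<And>j. 0 < \<sigma> j \<and> \<sigma> j < 1" and "strict_mono \<sigma>" and "\<sigma> \<longlonglongrightarrow> s"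
  shows "Gamma_converges (Lp p \<Omega>) (Lp_dist p \<Omega>)
           (\<lambda>j. energy_minus (\<sigma> j) p \<Omega>) (energy_minus s p \<Omega>)
       \<and> Gamma_converges (Lp p \<Omega>) (Lp_dist p \<Omega>)
           (\<lambda>j. energy (\<sigma> j) p \<Omega>) (energy_minus s p \<Omega>)"
proof -
  have "0 < p" using assms(3) by simp
  have "\<sigma> n \<le> s" for n
    using assms(7,8) by (intro incseq_le strict_mono_mono)
  then have less: "\<sigma> n < s" for n
    using strict_monoD[OF assms(7), of n "Suc n"] less_le_trans by blast
  have le: "energy_minus (\<sigma> n) p \<Omega> v \<le> energy (\<sigma> n) p \<Omega> v" for n v
    by (rule energy_minus_le_energy) fact+
  have liminf: "energy_minus s p \<Omega> u \<le> liminf (\<lambda>n. energy_minus (\<sigma> n) p \<Omega> (v n))"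
    if "u \<in> Lp p \<Omega>" "\<And>n. v n \<in> Lp p \<Omega>" "(\<lambda>n. Lp_dist p \<Omega> (v n) u) \<longlonglongrightarrow> 0" for u v
    using less by (intro energy_minus_liminf that assms \<open>0 < p\<close>) (simp add: less_imp_le)
  have limsup: "limsup (\<lambda>n. energy (\<sigma> n) p \<Omega> u) \<le> energy_minus s p \<Omega> u" if "u \<in> Lp p \<Omega>" for u
    using assms(6) by (intro energy_limsup that assms \<open>0 < p\<close> less) auto
  have dist: "Lp_dist p \<Omega> u u = 0" for u
    by (simp add: Lp_dist_def Lp_norm_def)
  show ?thesis
  proof
    show "Gamma_converges (Lp p \<Omega>) (Lp_dist p \<Omega>)
        (\<lambda>j. energy_minus (\<sigma> j) p \<Omega>) (energy_minus s p \<Omega>)"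
    proof (rule Gamma_converges_constant_recoveryI[OF liminf dist])
      show "limsup (\<lambda>n. energy_minus (\<sigma> n) p \<Omega> u) \<le> energy_minus s p \<Omega> u" if "u \<in> Lp p \<Omega>" for u
        by (rule order_trans[OF Limsup_mono limsup[OF that]]) (simp add: le)
    qed
    show "Gamma_converges (Lp p \<Omega>) (Lp_dist p \<Omega>)
        (\<lambda>j. energy (\<sigma> j) p \<Omega>) (energy_minus s p \<Omega>)"
    proof (rule Gamma_converges_constant_recoveryI[OF _ dist limsup])
      show "energy_minus s p \<Omega> u \<le> liminf (\<lambda>n. energy (\<sigma> n) p \<Omega> (v n))"
        if "u \<in> Lp p \<Omega>" "\<And>n. v n \<in> Lp p \<Omega>" "(\<lambda>n. Lp_dist p \<Omega> (v n) u) \<longlonglongrightarrow> 0" for u v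
        by (rule order_trans[OF liminf[OF that] Liminf_mono]) (simp add: le)
    qed
  qed
qed

end
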